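(* Let $(S;\cdot,\backslash,/)$ be a right product quasigroup. Then $S$ is a right product loop if and only if it satisfies any one (and hence all) of the following identities: (i) $(x\backslash x)\cdot y=y$; (ii) $x\cdot(y/y)=(x\cdot y)/y$; (iii) $x\cdot(y/y)=(x/y)\cdot y$; (iv) $(x\backslash x)\cdot z=(y/y)\cdot z$; (v) $(x\circ y)\backslash(x\circ y)=y/y$; (vi) $(x\circ y)/(x\circ y)=y\backslash y$; where in (v) and (vi) $\circ$ is any one of the operations $\cdot,\backslash,/$. That is, each of these identities (with (v) and (vi) counted as one identity for each choice of $\circ$) is individually equivalent to $S$ being a right product loop.
   Context: A quasigroup is an algebra $(Q;\cdot,\backslash,/)$ satisfying $x\backslash(x\cdot y)=y$, $x\cdot(x\backslash y)=y$, $(x\cdot y)/y=x$, $(x/y)\cdot y=x$. A loop (in the language of quasigroups) is a quasigroup satisfying $x\backslash x=y/y$. A right zero semigroup is regarded as an algebra $(R;\cdot,\backslash,/)$ with $x\cdot y=x\backslash y=x/y=y$. A right product quasigroup (respectively right product loop) is an algebra isomorphic to a direct product $Q\times R$ with $Q$ a quasigroup (respectively a loop) and $R$ a right zero semigroup. *)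

theory Defs
  imports "HOL-Algebra.Congruence"
begin

text \<open>Algebras \<open>(S; \<cdot>, \<setminus>, \<oslash>)\<close> with an explicit carrier set, in the style of HOL-Algebra.
  The empty algebra is allowed.\<close>

record 'a qalg = "'a partial_object" +
  mult :: "'a \<Rightarrow> 'a \<Rightarrow> 'a" (infixl "\<cdot>\<index>" 70)
  ldiv :: "'a \<Rightarrow> 'a \<Rightarrow> 'a" (infixl "\<setminus>\<index>" 70)
  rdiv :: "'a \<Rightarrow> 'a \<Rightarrow> 'a" (infixl "\<oslash>\<index>" 70)

locale qalgebra =
  fixes S :: "'a qalg" (structure)
  assumes mult_closed: "\<lbrakk>x \<in> carrier S; y \<in> carrier S\<rbrakk> \<Longrightarrow> x \<cdot> y \<in> carrier S"
    and ldiv_closed: "\<lbrakk>x \<in> carrier S; y \<in> carrier S\<rbrakk> \<Longrightarrow> x \<setminus> y \<in> carrier S"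
    and rdiv_closed: "\<lbrakk>x \<in> carrier S; y \<in> carrier S\<rbrakk> \<Longrightarrow> x \<oslash> y \<in> carrier S"

locale quasigroup = qalgebra Q for Q :: "'a qalg" (structure) +
  assumes ldiv_mult: "\<lbrakk>x \<in> carrier Q; y \<in> carrier Q\<rbrakk> \<Longrightarrow> x \<setminus> (x \<cdot> y) = y"
    and mult_ldiv: "\<lbrakk>x \<in> carrier Q; y \<in> carrier Q\<rbrakk> \<Longrightarrow> x \<cdot> (x \<setminus> y) = y"
    and mult_rdiv: "\<lbrakk>x \<in> carrier Q; y \<in> carrier Q\<rbrakk> \<Longrightarrow> (x \<cdot> y) \<oslash> y = x"
    and rdiv_mult: "\<lbrakk>x \<in> carrier Q; y \<in> carrier Q\<rbrakk> \<Longrightarrow> (x \<oslash> y) \<cdot> y = x"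

locale loop = quasigroup Q for Q :: "'a qalg" (structure) +
  assumes ldiv_self_eq_rdiv_self:
    "\<lbrakk>x \<in> carrier Q; y \<in> carrier Q\<rbrakk> \<Longrightarrow> x \<setminus> x = y \<oslash> y"

locale right_zero_semigroup =
  fixes R :: "'a qalg" (structure)
  assumes mult_right_zero: "\<lbrakk>x \<in> carrier R; y \<in> carrier R\<rbrakk> \<Longrightarrow> x \<cdot> y = y"
    and ldiv_right_zero: "\<lbrakk>x \<in> carrier R; y \<in> carrier R\<rbrakk> \<Longrightarrow> x \<setminus> y = y"
    and rdiv_right_zero: "\<lbrakk>x \<in> carrier R; y \<in> carrier R\<rbrakk> \<Longrightarrow> x \<oslash> y = y"

definition direct_product :: "'a qalg \<Rightarrow> 'b qalg \<Rightarrow> ('a \<times> 'b) qalg" where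
  "direct_product A B =
    \<lparr>carrier = carrier A \<times> carrier B,
     mult = (\<lambda>(a, b) (a', b'). (a \<cdot>\<^bsub>A\<^esub> a', b \<cdot>\<^bsub>B\<^esub> b')),
     ldiv = (\<lambda>(a, b) (a', b'). (a \<setminus>\<^bsub>A\<^esub> a', b \<setminus>\<^bsub>B\<^esub> b')),
     rdiv = (\<lambda>(a, b) (a', b'). (a \<oslash>\<^bsub>A\<^esub> a', b \<oslash>\<^bsub>B\<^esub> b'))\<rparr>"

definition qalg_iso :: "'a qalg \<Rightarrow> 'b qalg \<Rightarrow> ('a \<Rightarrow> 'b) set" where
  "qalg_iso A B = {h. bij_betw h (carrier A) (carrier B) \<and>
    (\<forall>x\<in>carrier A. \<forall>y\<in>carrier A.
      h (x \<cdot>\<^bsub>A\<^esub> y) = h x \<cdot>\<^bsub>B\<^esub> h y \<and>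
      h (x \<setminus>\<^bsub>A\<^esub> y) = h x \<setminus>\<^bsub>B\<^esub> h y \<and>
      h (x \<oslash>\<^bsub>A\<^esub> y) = h x \<oslash>\<^bsub>B\<^esub> h y)}"

definition qalg_isomorphic :: "'a qalg \<Rightarrow> 'b qalg \<Rightarrow> bool" where
  "qalg_isomorphic A B \<longleftrightarrow> qalg_iso A B \<noteq> {}"

text \<open>HOL cannot quantify existentially over types, so the two factors are taken on subsets of
  the type of \<open>S\<close>. This loses nothing: both factors of a nonempty product embed into it, and
  the lemmas \<open>right_product_quasigroupI\<close> and \<open>right_product_loopI\<close> below show that factors over
  arbitrary types give the same notions.\<close>

definition right_product_quasigroup :: "'a qalg \<Rightarrow> bool" where
  "right_product_quasigroup S \<longleftrightarrow> qalgebra S \<and>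
    (\<exists>(Q :: 'a qalg) (R :: 'a qalg).
      quasigroup Q \<and> right_zero_semigroup R \<and> qalg_isomorphic S (direct_product Q R))"

definition right_product_loop :: "'a qalg \<Rightarrow> bool" where
  "right_product_loop S \<longleftrightarrow> qalgebra S \<and>
    (\<exists>(Q :: 'a qalg) (R :: 'a qalg).
      loop Q \<and> right_zero_semigroup R \<and> qalg_isomorphic S (direct_product Q R))"

definition qalg_transport :: "('a \<Rightarrow> 'b) \<Rightarrow> 'a qalg \<Rightarrow> 'b qalg" where
  "qalg_transport f A = (let g = inv_into (carrier A) f in
    \<lparr>carrier = f ` carrier A,
     mult = (\<lambda>x y. f (g x \<cdot>\<^bsub>A\<^esub> g y)),
     ldiv = (\<lambda>x y. f (g x \<setminus>\<^bsub>A\<^esub> g y)),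
     rdiv = (\<lambda>x y. f (g x \<oslash>\<^bsub>A\<^esub> g y))\<rparr>)"

lemma quasigroup_transport:
  assumes "inj_on f (carrier Q)" and "quasigroup Q"
  shows "quasigroup (qalg_transport f Q)"
proof -
  interpret quasigroup Q by fact
  show ?thesis
    by unfold_locales
      (auto simp: qalg_transport_def Let_def assms(1) mult_closed ldiv_closed rdiv_closed
        ldiv_mult mult_ldiv mult_rdiv rdiv_mult)
qed

lemma loop_transport:
  assumes "inj_on f (carrier Q)" and "loop Q"
  shows "loop (qalg_transport f Q)"
proof -
  interpret loop Q by fact
  interpret T: quasigroup "qalg_transport f Q"
    by (rule quasigroup_transport[OF assms(1)]) unfold_locales
  show ?thesis
    by unfold_locales
      (auto simp: qalg_transport_def Let_def assms(1) intro!: arg_cong[of _ _ f] ldiv_self_eq_rdiv_self)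
qed

lemma right_zero_semigroup_transport:
  assumes "inj_on f (carrier R)" and "right_zero_semigroup R"
  shows "right_zero_semigroup (qalg_transport f R)"
proof -
  interpret right_zero_semigroup R by fact
  show ?thesis
    by unfold_locales
      (auto simp: qalg_transport_def Let_def assms(1) mult_right_zero ldiv_right_zero rdiv_right_zero)
qed

lemma direct_product_factors_transport:
  fixes S :: "'a qalg" and Q :: "'b qalg" and R :: "'c qalg"
  assumes S: "qalgebra S" and Q: "quasigroup Q" and R: "right_zero_semigroup R"
    and iso: "qalg_isomorphic S (direct_product Q R)"
    and ne: "carrier S \<noteq> {}"
  obtains f :: "'b \<Rightarrow> 'a" and g :: "'c \<Rightarrow> 'a"
  where "inj_on f (carrier Q)" and "inj_on g (carrier R)"
    and "qalg_isomorphic S (direct_product (qalg_transport f Q) (qalg_transport g R))"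
proof -
  interpret S: qalgebra S by fact
  interpret Q: quasigroup Q by fact
  interpret R: right_zero_semigroup R by fact
  obtain h where bij: "bij_betw h (carrier S) (carrier Q \<times> carrier R)"
    and hom: "\<And>x y. x \<in> carrier S \<Longrightarrow> y \<in> carrier S \<Longrightarrow>
      h (x \<cdot>\<^bsub>S\<^esub> y) = mult (direct_product Q R) (h x) (h y) \<and>
      h (x \<setminus>\<^bsub>S\<^esub> y) = ldiv (direct_product Q R) (h x) (h y) \<and>
      h (x \<oslash>\<^bsub>S\<^esub> y) = rdiv (direct_product Q R) (h x) (h y)"
    using iso by (auto simp: qalg_isomorphic_def qalg_iso_def direct_product_def)
  obtain s where "s \<in> carrier S" using ne by blast
  then have "h s \<in> carrier Q \<times> carrier R" using bij bij_betwE by blast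
  then obtain q0 r0 where q0: "q0 \<in> carrier Q" and r0: "r0 \<in> carrier R" by (cases "h s") auto
  define k where "k = inv_into (carrier S) h"
  have k_inj: "inj_on k (carrier Q \<times> carrier R)"
    unfolding k_def using bij by (metis bij_betw_inv_into bij_betw_def)
  define f where "f q = k (q, r0)" for q
  define g where "g r = k (q0, r)" for r
  have f: "inj_on f (carrier Q)" and g: "inj_on g (carrier R)"
    using k_inj q0 r0 by (auto simp: f_def g_def inj_on_def)
  have fg: "bij_betw (map_prod f g) (carrier Q \<times> carrier R) (f ` carrier Q \<times> g ` carrier R)"
    using f g by (auto simp: bij_betw_def map_prod_inj_on map_prod_surj_on)
  have "map_prod f g \<circ> h \<in> qalg_iso S (direct_product (qalg_transport f Q) (qalg_transport g R))"
    unfolding qalg_iso_def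
  proof (intro CollectI conjI ballI)
    show "bij_betw (map_prod f g \<circ> h) (carrier S)
        (carrier (direct_product (qalg_transport f Q) (qalg_transport g R)))"
      using bij_betw_trans[OF bij fg] by (simp add: direct_product_def qalg_transport_def Let_def)
  next
    fix x y assume xy: "x \<in> carrier S" "y \<in> carrier S"
    obtain a b where x: "h x = (a, b)" "a \<in> carrier Q" "b \<in> carrier R"
      using bij bij_betwE xy(1) by (metis mem_Sigma_iff surj_pair)
    obtain c d where y: "h y = (c, d)" "c \<in> carrier Q" "d \<in> carrier R"
      using bij bij_betwE xy(2) by (metis mem_Sigma_iff surj_pair)
    note simps = hom[OF xy] x y f g direct_product_def qalg_transport_def Let_def
    show "(map_prod f g \<circ> h) (x \<cdot>\<^bsub>S\<^esub> y) =
        mult (direct_product (qalg_transport f Q) (qalg_transport g R))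
          ((map_prod f g \<circ> h) x) ((map_prod f g \<circ> h) y)"
      by (simp add: simps)
    show "(map_prod f g \<circ> h) (x \<setminus>\<^bsub>S\<^esub> y) =
        ldiv (direct_product (qalg_transport f Q) (qalg_transport g R))
          ((map_prod f g \<circ> h) x) ((map_prod f g \<circ> h) y)"
      by (simp add: simps)
    show "(map_prod f g \<circ> h) (x \<oslash>\<^bsub>S\<^esub> y) =
        rdiv (direct_product (qalg_transport f Q) (qalg_transport g R))
          ((map_prod f g \<circ> h) x) ((map_prod f g \<circ> h) y)"
      by (simp add: simps)
  qed
  then show thesis using that[OF f g] by (auto simp: qalg_isomorphic_def)
qed

lemma empty_right_product_loop:
  fixes S :: "'a qalg"
  assumes "carrier S = {}"
  shows "right_product_loop S"
proof -
  have "qalgebra S" "loop S" "right_zero_semigroup S"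
    using assms by (simp_all add: qalgebra_def quasigroup_def quasigroup_axioms_def loop_def
      loop_axioms_def right_zero_semigroup_def)
  moreover have "(\<lambda>x. (x, x)) \<in> qalg_iso S (direct_product S S)"
    using assms by (simp add: qalg_iso_def direct_product_def bij_betw_def)
  ultimately show ?thesis
    unfolding right_product_loop_def qalg_isomorphic_def by blast
qed

lemma right_product_loop_imp_right_product_quasigroup:
  "right_product_loop S \<Longrightarrow> right_product_quasigroup S"
  unfolding right_product_loop_def right_product_quasigroup_def loop_def by blast

lemma right_product_quasigroupI:
  fixes S :: "'a qalg" and Q :: "'b qalg" and R :: "'c qalg"
  assumes "qalgebra S" "quasigroup Q" "right_zero_semigroup R"
    "qalg_isomorphic S (direct_product Q R)"
  shows "right_product_quasigroup S"
proof (cases "carrier S = {}")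
  case True
  then show ?thesis
    by (intro right_product_loop_imp_right_product_quasigroup empty_right_product_loop)
next
  case False
  show ?thesis
    by (rule direct_product_factors_transport[OF assms False])
      (use assms quasigroup_transport right_zero_semigroup_transport in
        \<open>unfold right_product_quasigroup_def, blast\<close>)
qed

lemma right_product_loopI:
  fixes S :: "'a qalg" and Q :: "'b qalg" and R :: "'c qalg"
  assumes "qalgebra S" "loop Q" "right_zero_semigroup R"
    "qalg_isomorphic S (direct_product Q R)"
  shows "right_product_loop S"
proof (cases "carrier S = {}")
  case True
  then show ?thesis by (rule empty_right_product_loop)
next
  case False
  have "quasigroup Q" using assms(2) by (simp add: loop_def)
  then show ?thesis
    by (rule direct_product_factors_transport[OF assms(1) _ assms(3,4) False])
      (use assms loop_transport right_zero_semigroup_transport in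
        \<open>unfold right_product_loop_def, blast\<close>)
qed

end

theory Submission
  imports Defs
begin

text \<open>Let \<open>S\<close> be isomorphic to \<open>Q \<times> R\<close> with \<open>Q\<close> a quasigroup and \<open>R\<close> a right zero semigroup. In
  \<open>R\<close> every term evaluates to its rightmost variable, and in each of the identities the two sides
  have the same rightmost variable; so each identity holds in \<open>R\<close>. If \<open>S\<close> is nonempty, then
  \<open>S\<close> projects onto \<open>Q\<close>, and hence \<open>S\<close> satisfies one of the identities iff \<open>Q\<close> does.

  This reduces the problem to quasigroups. There, after a cancellation, or after replacing
  \<open>x \<circ> y\<close> by an arbitrary element, each identity turns into \<open>x \<setminus> x = y \<oslash> y\<close>, the law that
  defines loops (lemmas \<open>loop_iff_\<dots>\<close>). So \<open>S\<close> satisfies the identity iff \<open>Q\<close> is a loop.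

  The definition of a right product loop only asks for some decomposition with a loop factor. Since
  the truth of an identity in \<open>S\<close> does not depend on the decomposition, the equivalence with
  \<open>Q\<close> being a loop, proved for all decompositions at once, gives the result
  (\<open>right_product_loop_iff_if_all_decompositions\<close>). The empty algebra is a right product loop
  and satisfies every identity.\<close>

section \<open>Loops among quasigroups\<close>

context quasigroup
begin

lemma loop_iff: "loop Q \<longleftrightarrow> (\<forall>x\<in>carrier Q. \<forall>y\<in>carrier Q. x \<setminus> x = y \<oslash> y)"
  using quasigroup_axioms by (auto simp: loop_def loop_axioms_def)

lemma mult_right_cancel:
  "\<lbrakk>x \<in> carrier Q; y \<in> carrier Q; z \<in> carrier Q\<rbrakk> \<Longrightarrow> x \<cdot> z = y \<cdot> z \<longleftrightarrow> x = y"
  by (metis mult_rdiv)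

lemma eq_ldiv_iff:
  "\<lbrakk>x \<in> carrier Q; y \<in> carrier Q; z \<in> carrier Q\<rbrakk> \<Longrightarrow> z = x \<setminus> y \<longleftrightarrow> x \<cdot> z = y"
  by (metis ldiv_mult mult_ldiv)

lemma eq_rdiv_iff:
  "\<lbrakk>x \<in> carrier Q; y \<in> carrier Q; z \<in> carrier Q\<rbrakk> \<Longrightarrow> z = x \<oslash> y \<longleftrightarrow> z \<cdot> y = x"
  by (metis mult_rdiv rdiv_mult)

lemma loop_iff_ldiv_self_left_neutral:
  "loop Q \<longleftrightarrow> (\<forall>x\<in>carrier Q. \<forall>y\<in>carrier Q. (x \<setminus> x) \<cdot> y = y)"
  unfolding loop_iff by (simp add: eq_rdiv_iff ldiv_closed)

lemma loop_iff_rdiv_self_right_neutral: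
  "loop Q \<longleftrightarrow> (\<forall>x\<in>carrier Q. \<forall>y\<in>carrier Q. x \<cdot> (y \<oslash> y) = x)"
  unfolding loop_iff by (metis eq_ldiv_iff rdiv_closed)

lemma loop_iff_mult_rdiv_assoc:
  "loop Q \<longleftrightarrow> (\<forall>x\<in>carrier Q. \<forall>y\<in>carrier Q. x \<cdot> (y \<oslash> y) = (x \<cdot> y) \<oslash> y)"
  unfolding loop_iff_rdiv_self_right_neutral by (simp add: mult_rdiv)

lemma loop_iff_mult_rdiv_self_eq_rdiv_mult:
  "loop Q \<longleftrightarrow> (\<forall>x\<in>carrier Q. \<forall>y\<in>carrier Q. x \<cdot> (y \<oslash> y) = (x \<oslash> y) \<cdot> y)"
  unfolding loop_iff_rdiv_self_right_neutral by (simp add: rdiv_mult)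

lemma loop_iff_ldiv_self_mult_eq_rdiv_self_mult:
  "loop Q \<longleftrightarrow> (\<forall>x\<in>carrier Q. \<forall>y\<in>carrier Q. \<forall>z\<in>carrier Q.
    (x \<setminus> x) \<cdot> z = (y \<oslash> y) \<cdot> z)"
  unfolding loop_iff by (auto simp: mult_right_cancel ldiv_closed rdiv_closed)

text \<open>Each of the three operations is surjective in its left argument: the equation
  \<open>x \<circ> y = u\<close> is solved by \<open>u \<oslash> y\<close>, \<open>y \<oslash> u\<close> and \<open>u \<cdot> y\<close> respectively. So \<open>x \<circ> y\<close> may be
  replaced by a variable that is independent of \<open>y\<close>.\<close>

lemma ball_left_argument_iff:
  assumes "f \<in> {mult Q, ldiv Q, rdiv Q}"
  shows "(\<forall>x\<in>carrier Q. \<forall>y\<in>carrier Q. P (f x y) y) \<longleftrightarrow> (\<forall>u\<in>carrier Q. \<forall>y\<in>carrier Q. P u y)"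
proof -
  have "f x y \<in> carrier Q" if "x \<in> carrier Q" "y \<in> carrier Q" for x y
    using assms that by (auto simp: mult_closed ldiv_closed rdiv_closed)
  moreover have "\<exists>x\<in>carrier Q. u = f x y" if "u \<in> carrier Q" "y \<in> carrier Q" for u y
  proof -
    have "y \<oslash> u \<setminus> y = u"
      using that by (metis eq_ldiv_iff rdiv_closed rdiv_mult)
    then show ?thesis
      using assms that by (auto intro: bexI[of _ "u \<oslash> y"] bexI[of _ "y \<oslash> u"] bexI[of _ "u \<cdot> y"]
          simp: mult_closed rdiv_closed mult_rdiv rdiv_mult)
  qed
  ultimately show ?thesis by (intro iffI ballI) blast+
qed

lemma loop_iff_ldiv_self_op_eq_rdiv_self:
  assumes "f \<in> {mult Q, ldiv Q, rdiv Q}"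
  shows "loop Q \<longleftrightarrow>
    (\<forall>x\<in>carrier Q. \<forall>y\<in>carrier Q. (f x y) \<setminus> (f x y) = y \<oslash> y)"
  using ball_left_argument_iff[OF assms, where P = "\<lambda>u y. u \<setminus> u = y \<oslash> y"] by (simp add: loop_iff)

lemma loop_iff_rdiv_self_op_eq_ldiv_self:
  assumes "f \<in> {mult Q, ldiv Q, rdiv Q}"
  shows "loop Q \<longleftrightarrow>
    (\<forall>x\<in>carrier Q. \<forall>y\<in>carrier Q. (f x y) \<oslash> (f x y) = y \<setminus> y)"
proof -
  have "loop Q \<longleftrightarrow> (\<forall>u\<in>carrier Q. \<forall>y\<in>carrier Q. u \<oslash> u = y \<setminus> y)"
    unfolding loop_iff by metis
  then show ?thesis
    using ball_left_argument_iff[OF assms, where P = "\<lambda>u y. u \<oslash> u = y \<setminus> y"] by simp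
qed

end

section \<open>Transfer along a decomposition\<close>

text \<open>If \<open>R\<close> is empty, then so is \<open>S\<close>, whatever \<open>Q\<close> is, and nothing can be learned about \<open>Q\<close>
  from \<open>S\<close>. Nonemptiness of \<open>S\<close> makes the projection onto \<open>Q\<close> surjective.\<close>

locale right_product_decomposition =
  S: qalgebra S + Q: quasigroup Q + R: right_zero_semigroup R
  for S :: "'a qalg" (structure) and Q :: "'b qalg" and R :: "'c qalg" +
  fixes h :: "'a \<Rightarrow> 'b \<times> 'c"
  assumes iso: "h \<in> qalg_iso S (direct_product Q R)"
    and nonempty: "carrier S \<noteq> {}"
begin

definition left_proj :: "'a \<Rightarrow> 'b" where "left_proj x = fst (h x)"
definition right_proj :: "'a \<Rightarrow> 'c" where "right_proj x = snd (h x)"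

lemma bij: "bij_betw h (carrier S) (carrier Q \<times> carrier R)"
  using iso by (simp add: qalg_iso_def direct_product_def)

lemma proj_closed:
  assumes "x \<in> carrier S"
  shows "left_proj x \<in> carrier Q" "right_proj x \<in> carrier R"
  using bij_betwE[OF bij] assms by (auto simp: left_proj_def right_proj_def mem_Times_iff)

lemma eq_iff_proj_eq:
  "\<lbrakk>x \<in> carrier S; y \<in> carrier S\<rbrakk>
    \<Longrightarrow> x = y \<longleftrightarrow> left_proj x = left_proj y \<and> right_proj x = right_proj y"
  using bij by (metis bij_betw_imp_inj_on inj_onD left_proj_def prod_eqI right_proj_def)

lemma left_proj_image: "left_proj ` carrier S = carrier Q"
proof -
  have "left_proj ` carrier S = fst ` (carrier Q \<times> carrier R)"
    using bij by (auto simp: left_proj_def bij_betw_def image_image[symmetric])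
  moreover have "carrier R \<noteq> {}"
    using nonempty proj_closed(2) by blast
  ultimately show ?thesis by simp
qed

lemma left_proj_hom:
  assumes "x \<in> carrier S" "y \<in> carrier S"
  shows "left_proj (x \<cdot> y) = left_proj x \<cdot>\<^bsub>Q\<^esub> left_proj y"
    and "left_proj (x \<setminus> y) = left_proj x \<setminus>\<^bsub>Q\<^esub> left_proj y"
    and "left_proj (x \<oslash> y) = left_proj x \<oslash>\<^bsub>Q\<^esub> left_proj y"
  using iso assms
  by (simp_all add: qalg_iso_def direct_product_def left_proj_def case_prod_beta)

lemma right_proj_op:
  assumes "x \<in> carrier S" "y \<in> carrier S"
  shows "right_proj (x \<cdot> y) = right_proj y"
    and "right_proj (x \<setminus> y) = right_proj y"
    and "right_proj (x \<oslash> y) = right_proj y"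
  using iso assms proj_closed(2)[OF assms(1)] proj_closed(2)[OF assms(2)]
  by (simp_all add: qalg_iso_def direct_product_def right_proj_def case_prod_beta
      R.mult_right_zero R.ldiv_right_zero R.rdiv_right_zero)

lemma ball_left_factor_iff:
  "(\<forall>a\<in>carrier Q. P a) \<longleftrightarrow> (\<forall>x\<in>carrier S. P (left_proj x))"
  by (simp add: left_proj_image[symmetric])

text \<open>As simplification rules, these facts turn a universally quantified identity of \<open>Q\<close>, and the
  same identity of \<open>S\<close>, into the same statement about left projections, provided that the
  right projections of both sides agree, that is, both sides have the same rightmost variable.\<close>

lemmas transfer = ball_left_factor_iff eq_iff_proj_eq left_proj_hom right_proj_op
  S.mult_closed S.ldiv_closed S.rdiv_closed

lemma loop_factor_iff_identities:
  "loop Q \<longleftrightarrow> (\<forall>x\<in>carrier S. \<forall>y\<in>carrier S. (x \<setminus> x) \<cdot> y = y)"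
  "loop Q \<longleftrightarrow>
    (\<forall>x\<in>carrier S. \<forall>y\<in>carrier S. x \<cdot> (y \<oslash> y) = (x \<cdot> y) \<oslash> y)"
  "loop Q \<longleftrightarrow>
    (\<forall>x\<in>carrier S. \<forall>y\<in>carrier S. x \<cdot> (y \<oslash> y) = (x \<oslash> y) \<cdot> y)"
  "loop Q \<longleftrightarrow> (\<forall>x\<in>carrier S. \<forall>y\<in>carrier S. \<forall>z\<in>carrier S.
    (x \<setminus> x) \<cdot> z = (y \<oslash> y) \<cdot> z)"
  subgoal unfolding Q.loop_iff_ldiv_self_left_neutral by (simp add: transfer)
  subgoal unfolding Q.loop_iff_mult_rdiv_assoc by (simp add: transfer)
  subgoal unfolding Q.loop_iff_mult_rdiv_self_eq_rdiv_mult by (simp add: transfer)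
  subgoal unfolding Q.loop_iff_ldiv_self_mult_eq_rdiv_self_mult by (simp add: transfer)
  done

lemma loop_factor_iff_op_identities:
  assumes "f \<in> {mult S, ldiv S, rdiv S}"
  shows "loop Q \<longleftrightarrow>
      (\<forall>x\<in>carrier S. \<forall>y\<in>carrier S. (f x y) \<setminus> (f x y) = y \<oslash> y)"
    and "loop Q \<longleftrightarrow>
      (\<forall>x\<in>carrier S. \<forall>y\<in>carrier S. (f x y) \<oslash> (f x y) = y \<setminus> y)"
proof -
  \<comment> \<open>\<open>g\<close> is the operation of \<open>Q\<close> of the same name as \<open>f\<close>.\<close>
  have "\<exists>g\<in>{mult Q, ldiv Q, rdiv Q}. \<forall>x\<in>carrier S. \<forall>y\<in>carrier S. f x y \<in> carrier S \<and>
      left_proj (f x y) = g (left_proj x) (left_proj y) \<and> right_proj (f x y) = right_proj y"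
    using assms by (auto simp: left_proj_hom right_proj_op
        S.mult_closed S.ldiv_closed S.rdiv_closed)
  then obtain g where g: "g \<in> {mult Q, ldiv Q, rdiv Q}"
    and f: "\<And>x y. \<lbrakk>x \<in> carrier S; y \<in> carrier S\<rbrakk> \<Longrightarrow> f x y \<in> carrier S \<and>
      left_proj (f x y) = g (left_proj x) (left_proj y) \<and> right_proj (f x y) = right_proj y"
    by blast
  note loop_iff = Q.loop_iff_ldiv_self_op_eq_rdiv_self[OF g]
    Q.loop_iff_rdiv_self_op_eq_ldiv_self[OF g]
  show "loop Q \<longleftrightarrow>
      (\<forall>x\<in>carrier S. \<forall>y\<in>carrier S. (f x y) \<setminus> (f x y) = y \<oslash> y)"
    unfolding loop_iff(1) by (simp add: transfer f)
  show "loop Q \<longleftrightarrow>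
      (\<forall>x\<in>carrier S. \<forall>y\<in>carrier S. (f x y) \<oslash> (f x y) = y \<setminus> y)"
    unfolding loop_iff(2) by (simp add: transfer f)
qed

end

section \<open>Identities for right product loops\<close>

text \<open>A given decomposition of \<open>S\<close> need not be the one that exhibits \<open>S\<close> as a product with a
  loop. The criterion \<open>P\<close> is a property of \<open>S\<close> alone that detects loop factors in every
  decomposition, so it carries the information from one decomposition to the other.\<close>

lemma right_product_loop_iff_if_all_decompositions:
  fixes S :: "'a qalg"
  assumes S: "right_product_quasigroup S"
    and trivial: "carrier S = {} \<Longrightarrow> P"
    and decomposition: "\<And>(Q :: 'a qalg) (R :: 'a qalg) h.
      right_product_decomposition S Q R h \<Longrightarrow> loop Q \<longleftrightarrow> P"
  shows "right_product_loop S \<longleftrightarrow> P"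
proof (cases "carrier S = {}")
  case True
  then show ?thesis using empty_right_product_loop trivial by blast
next
  case False
  have "right_product_loop S \<longleftrightarrow> (\<exists>(Q :: 'a qalg) (R :: 'a qalg) h.
      right_product_decomposition S Q R h \<and> loop Q)"
    using False unfolding right_product_loop_def qalg_isomorphic_def
      right_product_decomposition_def right_product_decomposition_axioms_def loop_def by blast
  moreover have "\<exists>(Q :: 'a qalg) (R :: 'a qalg) h. right_product_decomposition S Q R h"
    using S False unfolding right_product_quasigroup_def qalg_isomorphic_def
      right_product_decomposition_def right_product_decomposition_axioms_def by blast
  ultimately show ?thesis using decomposition by blast
qed

theorem corollary2p21:
  fixes S :: "'a qalg" (structure)
  assumes "right_product_quasigroup S"
  shows
    "(right_product_loop S \<longleftrightarrow>
        (\<forall>x\<in>carrier S. \<forall>y\<in>carrier S. (x \<setminus> x) \<cdot> y = y)) \<and>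
     (right_product_loop S \<longleftrightarrow>
        (\<forall>x\<in>carrier S. \<forall>y\<in>carrier S. x \<cdot> (y \<oslash> y) = (x \<cdot> y) \<oslash> y)) \<and>
     (right_product_loop S \<longleftrightarrow>
        (\<forall>x\<in>carrier S. \<forall>y\<in>carrier S. x \<cdot> (y \<oslash> y) = (x \<oslash> y) \<cdot> y)) \<and>
     (right_product_loop S \<longleftrightarrow>
        (\<forall>x\<in>carrier S. \<forall>y\<in>carrier S. \<forall>z\<in>carrier S.
          (x \<setminus> x) \<cdot> z = (y \<oslash> y) \<cdot> z)) \<and>
     (\<forall>f\<in>{mult S, ldiv S, rdiv S}.
        right_product_loop S \<longleftrightarrow>
        (\<forall>x\<in>carrier S. \<forall>y\<in>carrier S. (f x y) \<setminus> (f x y) = y \<oslash> y)) \<and>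
     (\<forall>f\<in>{mult S, ldiv S, rdiv S}.
        right_product_loop S \<longleftrightarrow>
        (\<forall>x\<in>carrier S. \<forall>y\<in>carrier S. (f x y) \<oslash> (f x y) = y \<setminus> y))"
proof (intro conjI ballI, goal_cases)
  case 1
  show ?case
    by (rule right_product_loop_iff_if_all_decompositions[OF assms])
      (simp, rule right_product_decomposition.loop_factor_iff_identities(1))
next
  case 2
  show ?case
    by (rule right_product_loop_iff_if_all_decompositions[OF assms])
      (simp, rule right_product_decomposition.loop_factor_iff_identities(2))
next
  case 3
  show ?case
    by (rule right_product_loop_iff_if_all_decompositions[OF assms])
      (simp, rule right_product_decomposition.loop_factor_iff_identities(3))
next
  case 4
  show ?case
    by (rule right_product_loop_iff_if_all_decompositions[OF assms])
      (simp, rule right_product_decomposition.loop_factor_iff_identities(4))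
next
  case (5 f)
  then show ?case
    by (intro right_product_loop_iff_if_all_decompositions[OF assms])
      (simp, rule right_product_decomposition.loop_factor_iff_op_identities(1))
next
  case (6 f)
  then show ?case
    by (intro right_product_loop_iff_if_all_decompositions[OF assms])
      (simp, rule right_product_decomposition.loop_factor_iff_op_identities(2))
qed

end
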